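(* Let $\mathcal{B}$ be a Banach space, let $\Gamma$ be the complete graph with $d+1$ vertices ($d\ge 1$), and let $\rho:[0,\infty)\to[0,1]$ be nonincreasing. Suppose $u:\Gamma\times\mathbf{Z}_{\ge 0}\to\mathcal{B}$ satisfies $\partial_t u=L_\mu u$ with $\mu^t_{v,\tilde v}=\rho(\|u(v,t)-u(\tilde v,t)\|_{\mathcal{B}})$, that is, for all $v\in\Gamma$ and all integers $t\ge 0$, $$u(v,t+1)-u(v,t)=\frac1d\sum_{\tilde v\neq v}[u(\tilde v,t)-u(v,t)]\,\rho(\|u(v,t)-u(\tilde v,t)\|_{\mathcal{B}}).$$ If $a=\rho(\|\nabla u(\cdot,0)\|_\infty)>0$, then for every integer $t\ge0$ $$\|\nabla u(\cdot,t)\|_\infty\le e^{-a\,t\left(\frac{d-1}{d}\right)}\,\|\nabla u(\cdot,0)\|_\infty$$ and $$\|u(\cdot,t)-\mathcal{A}_{u(\cdot,t)}\|_\infty\le\frac{2d}{d+1}\,e^{-a\,t\left(\frac{d-1}{d}\right)}\,\|u(\cdot,0)-\mathcal{A}_{u(\cdot,0)}\|_\infty .$$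
   Context: For a map $w:\Gamma\to\mathcal{B}$: $\|\nabla w\|_\infty=\max_{v,\tilde v\in\Gamma}\|w(v)-w(\tilde v)\|_{\mathcal{B}}$; $\mathcal{A}_w=\frac{1}{d+1}\sum_{v\in\Gamma}w(v)$ is the average; and $\|w-\mathcal{A}_w\|_\infty=\max_{v\in\Gamma}\|w(v)-\mathcal{A}_w\|_{\mathcal{B}}$. Time is discrete and $\partial_t u(v,t)=u(v,t+1)-u(v,t)$. *)

theory Defs
  imports "HOL-Analysis.Analysis" "Graph_Theory.Kuratowski"
begin

text \<open>
  Maps on the vertices of a graph are total functions of which only the values on
  \<open>verts G\<close> are relevant.  The two maxima below are meaningful for a finite, nonempty
  vertex set, as is the case for a complete graph on \<open>d + 1\<close> vertices.
\<close>

definition grad_norm :: "('v, 'e) pre_digraph \<Rightarrow> ('v \<Rightarrow> 'b::real_normed_vector) \<Rightarrow> real" where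
  "grad_norm G w = Max {norm (w v - w v') | v v'. v \<in> verts G \<and> v' \<in> verts G}"

definition average :: "('v, 'e) pre_digraph \<Rightarrow> ('v \<Rightarrow> 'b::real_normed_vector) \<Rightarrow> 'b" where
  "average G w = (1 / real (card (verts G))) *\<^sub>R (\<Sum>v\<in>verts G. w v)"

definition sup_norm :: "('v, 'e) pre_digraph \<Rightarrow> ('v \<Rightarrow> 'b::real_normed_vector) \<Rightarrow> real" where
  "sup_norm G w = Max {norm (w v) | v. v \<in> verts G}"

definition time_diff :: "('v \<Rightarrow> nat \<Rightarrow> 'b::real_normed_vector) \<Rightarrow> 'v \<Rightarrow> nat \<Rightarrow> 'b" where
  "time_diff u v t = u v (t + 1) - u v t"

text \<open>
  The Laplacian with edge weights \<open>\<mu>\<close>, normalised by the degree of the vertex and not by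
  the total weight at the vertex.
\<close>

definition laplacian ::
    "('v, 'e) pre_digraph \<Rightarrow> ('v \<Rightarrow> 'v \<Rightarrow> real) \<Rightarrow> ('v \<Rightarrow> 'b::real_normed_vector) \<Rightarrow> 'v \<Rightarrow> 'b" where
  "laplacian G \<mu> w v =
     (1 / real (card {v'. v \<rightarrow>\<^bsub>G\<^esub> v'})) *\<^sub>R (\<Sum>v' | v \<rightarrow>\<^bsub>G\<^esub> v'. \<mu> v v' *\<^sub>R (w v' - w v))"

lemma laplacian_complete:
  assumes "complete_digraph (d + 1) G" and "v \<in> verts G"
  shows "laplacian G \<mu> w v =
    (1 / real d) *\<^sub>R (\<Sum>v' \<in> verts G - {v}. \<mu> v v' *\<^sub>R (w v' - w v))"
proof -
  have nb: "{v'. v \<rightarrow>\<^bsub>G\<^esub> v'} = verts G - {v}"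
    using assms by (auto simp: complete_digraph_def)
  have "card (verts G - {v}) = d"
    using assms by (simp add: complete_digraph_def)
  then show ?thesis
    unfolding laplacian_def nb by simp
qed

lemma average_complete:
  assumes "complete_digraph (d + 1) G"
  shows "average G w = (1 / (real d + 1)) *\<^sub>R (\<Sum>v\<in>verts G. w v)"
  using assms by (simp add: average_def complete_digraph_def add.commute)

end

theory Submission
  imports Defs
begin

text \<open>
  One time step replaces every \<open>u v\<close> by a convex combination of the values of \<open>u\<close>, with weights
  \<open>P v z\<close>.  The diagonal weights are nonnegative because \<open>\<rho> \<le> 1\<close>, and as long as the gradient has
  not grown, the monotonicity of \<open>\<rho>\<close> gives off-diagonal weights of at least \<open>a / d\<close>.  Hence the
  rows of \<open>v\<close> and \<open>v'\<close> share the mass \<open>a / d\<close> at each of the \<open>d - 1\<close> other vertices; this mass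
  cancels in the difference, and the gradient contracts by
  \<open>1 - a * (d - 1) / d \<le> exp (- a * (d - 1) / d)\<close>.  The second bound follows from
  \<open>(d + 1) / d * sup_norm (w - average w) \<le> grad_norm w \<le> 2 * sup_norm (w - average w)\<close>.
\<close>

text \<open>Couple the two weightings by the product weights \<open>q z * r y\<close>. After scaling
  by the common mass \<open>s\<close>, both sums become double sums with these weights, so their
  difference is a combination of the differences \<open>x z - x y\<close> with total weight
  \<open>s * s\<close>. One factor \<open>s\<close> then cancels.\<close>

lemma norm_diff_weighted_sums_le:
  fixes x :: "'v \<Rightarrow> 'b::real_normed_vector"
  assumes q: "\<And>z. z \<in> V \<Longrightarrow> 0 \<le> q z" and r: "\<And>z. z \<in> V \<Longrightarrow> 0 \<le> r z"
    and sq: "sum q V = s" and sr: "sum r V = s" and "s > 0"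
    and D: "\<And>z y. z \<in> V \<Longrightarrow> y \<in> V \<Longrightarrow> norm (x z - x y) \<le> D"
  shows "norm ((\<Sum>z\<in>V. q z *\<^sub>R x z) - (\<Sum>z\<in>V. r z *\<^sub>R x z)) \<le> s * D"
proof -
  let ?A = "\<Sum>z\<in>V. q z *\<^sub>R x z" and ?B = "\<Sum>z\<in>V. r z *\<^sub>R x z"
  have "s *\<^sub>R ?A = (\<Sum>z\<in>V. \<Sum>y\<in>V. (q z * r y) *\<^sub>R x z)"
    by (simp add: sr[symmetric] scaleR_sum_right mult.commute sum_distrib_left
        flip: scaleR_sum_left)
  moreover have "s *\<^sub>R ?B = (\<Sum>z\<in>V. \<Sum>y\<in>V. (q z * r y) *\<^sub>R x y)"
    by (subst sum.swap) (simp add: sq[symmetric] scaleR_sum_right sum_distrib_right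
        flip: scaleR_sum_left)
  ultimately have "s *\<^sub>R (?A - ?B) = (\<Sum>z\<in>V. \<Sum>y\<in>V. (q z * r y) *\<^sub>R (x z - x y))"
    by (simp add: scaleR_diff_right sum_subtractf)
  also have "norm \<dots> \<le> (\<Sum>z\<in>V. \<Sum>y\<in>V. q z * r y * D)"
    by (intro sum_norm_le) (simp add: q r D mult_left_mono)
  also have "\<dots> = s * s * D"
    unfolding sum_distrib_right[symmetric] sum_product[symmetric] by (simp add: sq sr)
  finally have "s * norm (?A - ?B) \<le> s * (s * D)"
    using \<open>s > 0\<close> by (simp add: mult.assoc)
  then show ?thesis
    using \<open>s > 0\<close> by simp
qed

lemma averaging_step_contracts:
  fixes x :: "'v \<Rightarrow> 'b::real_normed_vector"
  assumes fin: "finite V" and card: "card V = d + 1" and d: "d \<ge> 1"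
    and p: "\<And>v z. v \<in> V \<Longrightarrow> z \<in> V \<Longrightarrow> a \<le> p v z \<and> p v z \<le> 1" and a: "0 \<le> a" "a \<le> 1"
    and D: "\<And>z y. z \<in> V \<Longrightarrow> y \<in> V \<Longrightarrow> norm (x z - x y) \<le> D"
    and x': "\<And>v. v \<in> V \<Longrightarrow> x' v = x v + (1 / real d) *\<^sub>R (\<Sum>z\<in>V - {v}. p v z *\<^sub>R (x z - x v))"
    and v: "v \<in> V" and w: "w \<in> V"
  shows "norm (x' v - x' w) \<le> (1 - a * ((real d - 1) / real d)) * D"
proof -
  \<comment> \<open>\<open>s\<close> is the mass left in a row once \<open>a / d\<close> has been
    removed at \<open>d - 1\<close> vertices. It is strictly positive because
    \<open>(d - 1) / d < 1\<close>, even for \<open>a = 1\<close>.\<close>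
  define s where "s = 1 - a * ((real d - 1) / real d)"
  have "a * ((real d - 1) / real d) \<le> 1 * ((real d - 1) / real d)"
    using a d by (intro mult_right_mono) auto
  also have "\<dots> < 1"
    using d by simp
  finally have s: "s > 0"
    by (simp add: s_def)
  show ?thesis
  proof (cases "v = w")
    case True
    \<comment> \<open>The instance \<open>D[OF v v]\<close> serves only to give
      \<open>0 \<le> D\<close>.\<close>
    then show ?thesis
      using s D[OF v v] by (simp add: s_def)
  next
    case False
    \<comment> \<open>\<open>P i\<close> is the row of weights that yields \<open>x' i\<close>,
      \<open>m\<close> the part common to the rows of \<open>v\<close> and \<open>w\<close>, and
      \<open>q i\<close> the remainder. \<open>m\<close> vanishes at \<open>v\<close> and
      \<open>w\<close> because a diagonal weight may be as small as 0, which leaves no guaranteed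
      overlap there.\<close>
    define P where "P i z = (if z = i then 1 - (\<Sum>y\<in>V - {i}. p i y) / d else p i z / d)" for i z
    define m where "m z = (if z \<in> {v, w} then 0 else a / d)" for z
    define q where "q i z = P i z - m z" for i z
    have sum_P: "sum (P i) V = 1" if "i \<in> V" for i
    proof -
      have "sum (P i) V = P i i + sum (P i) (V - {i})"
        using fin that by (rule sum.remove)
      also have "sum (P i) (V - {i}) = (\<Sum>y\<in>V - {i}. p i y / d)"
        by (intro sum.cong) (auto simp: P_def)
      finally show ?thesis
        by (simp add: P_def sum_divide_distrib)
    qed
    have "sum m V = (\<Sum>z\<in>V - {v, w}. a / d)"
      using fin by (intro sum.mono_neutral_cong_right) (auto simp: m_def)
    moreover have "card (V - {v, w}) = d - 1"
      using fin card v w False by (simp add: card_Diff_subset)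
    ultimately have sum_m: "sum m V = 1 - s"
      using d by (simp add: s_def of_nat_diff)
    have sum_q: "sum (q i) V = s" if "i \<in> V" for i
      using sum_P[OF that] sum_m by (simp add: q_def sum_subtractf)
    have q_nonneg: "0 \<le> q i z" if i: "i \<in> {v, w}" and z: "z \<in> V" for i z
    proof (cases "z = i")
      case True
      \<comment> \<open>The diagonal weight is nonnegative since at most \<open>d\<close> is
        subtracted before dividing by \<open>d\<close>.\<close>
      have "(\<Sum>y\<in>V - {i}. p i y) \<le> (\<Sum>y\<in>V - {i}. 1)"
        using p i v w by (intro sum_mono) auto
      also have "\<dots> = d"
        using fin card i v w by auto
      finally show ?thesis
        using True i d by (auto simp: q_def P_def m_def)
    next
      case False
      \<comment> \<open>If \<open>z\<close> is the other one of \<open>v\<close> and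
        \<open>w\<close>, then \<open>q i z = p i z / d\<close>; at any further vertex it is
        \<open>(p i z - a) / d\<close>.\<close>
      then show ?thesis
        using p[of i z] i z v w a d
        by (auto simp: q_def P_def m_def intro: divide_right_mono)
    qed
    have step: "x' i = (\<Sum>z\<in>V. P i z *\<^sub>R x z)" if "i \<in> V" for i
    proof -
      have "(\<Sum>z\<in>V. P i z *\<^sub>R x z) = P i i *\<^sub>R x i + (\<Sum>z\<in>V - {i}. P i z *\<^sub>R x z)"
        using fin that by (rule sum.remove)
      also have "(\<Sum>z\<in>V - {i}. P i z *\<^sub>R x z) = (1 / d) *\<^sub>R (\<Sum>z\<in>V - {i}. p i z *\<^sub>R x z)"
        by (simp add: scaleR_sum_right P_def)
      finally show ?thesis
        by (simp add: x'[OF that] P_def scaleR_diff_right scaleR_diff_left sum_subtractf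
            flip: scaleR_sum_left)
    qed
    \<comment> \<open>The common part \<open>m\<close> cancels, leaving two rows of equal mass
      \<open>s\<close>.\<close>
    have "x' v - x' w = (\<Sum>z\<in>V. q v z *\<^sub>R x z) - (\<Sum>z\<in>V. q w z *\<^sub>R x z)"
      by (simp add: step v w q_def scaleR_diff_left sum_subtractf)
    also have "norm \<dots> \<le> s * D"
      using q_nonneg sum_q v w s D by (intro norm_diff_weighted_sums_le) auto
    finally show ?thesis
      by (simp add: s_def)
  qed
qed

lemma grad_norm_eq_Max_image:
  "grad_norm G w = Max ((\<lambda>(v, v'). norm (w v - w v')) ` (verts G \<times> verts G))"
  unfolding grad_norm_def by (rule arg_cong[where f = Max]) auto

lemma grad_norm_ge:
  assumes "finite (verts G)" "v \<in> verts G" "v' \<in> verts G"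
  shows "norm (w v - w v') \<le> grad_norm G w"
  unfolding grad_norm_eq_Max_image using assms by (intro Max_ge) auto

lemma grad_norm_le:
  assumes "finite (verts G)" "verts G \<noteq> {}"
    and "\<And>v v'. v \<in> verts G \<Longrightarrow> v' \<in> verts G \<Longrightarrow> norm (w v - w v') \<le> D"
  shows "grad_norm G w \<le> D"
  unfolding grad_norm_eq_Max_image using assms by (intro Max.boundedI) auto

lemma sup_norm_eq_Max_image: "sup_norm G w = Max ((\<lambda>v. norm (w v)) ` verts G)"
  unfolding sup_norm_def by (rule arg_cong[where f = Max]) auto

text \<open>Triangle inequality through the point \<open>c\<close>, later taken to be the average at
  time 0.\<close>

lemma grad_norm_le_sup_norm:
  assumes "finite (verts G)" "verts G \<noteq> {}"
  shows "grad_norm G w \<le> 2 * sup_norm G (\<lambda>v. w v - c)"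
proof (rule grad_norm_le[OF assms])
  fix v v' assume "v \<in> verts G" "v' \<in> verts G"
  then have "norm (w v - c) \<le> sup_norm G (\<lambda>v. w v - c)"
    and "norm (w v' - c) \<le> sup_norm G (\<lambda>v. w v - c)"
    unfolding sup_norm_eq_Max_image using assms by auto
  then show "norm (w v - w v') \<le> 2 * sup_norm G (\<lambda>v. w v - c)"
    using norm_triangle_ineq4[of "w v - c" "w v' - c"] by simp
qed

text \<open>The deviation at \<open>v\<close> is the mean of the \<open>d + 1\<close> differences
  \<open>w v - w z\<close>. The one with \<open>z = v\<close> is zero, which gives the factor
  \<open>d / (d + 1)\<close> instead of 1.\<close>

lemma sup_norm_average_le_grad_norm:
  assumes "finite (verts G)" and card: "card (verts G) = d + 1"
  shows "sup_norm G (\<lambda>v. w v - average G w) \<le> real d / (real d + 1) * grad_norm G w"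
proof -
  have "norm (w v - average G w) \<le> real d / (real d + 1) * grad_norm G w" if v: "v \<in> verts G" for v
  proof -
    have "(real d + 1) *\<^sub>R (w v - average G w) = (\<Sum>z\<in>verts G. w v - w z)"
      by (simp add: average_def card sum_subtractf sum_constant_scaleR algebra_simps
          del: sum_constant)
    also have "\<dots> = (\<Sum>z\<in>verts G - {v}. w v - w z)"
      using assms(1) v by (simp add: sum.remove)
    also have "norm \<dots> \<le> (\<Sum>z\<in>verts G - {v}. grad_norm G w)"
      using assms(1) v by (intro sum_norm_le) (simp add: grad_norm_ge)
    also have "\<dots> = d * grad_norm G w"
      using assms v by simp
    finally have "(real d + 1) * norm (w v - average G w) \<le> d * grad_norm G w"
      by simp
    then show ?thesis
      by (simp add: field_simps)
  qed
  moreover have "verts G \<noteq> {}"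
    using card by auto
  ultimately show ?thesis
    using assms(1) by (simp add: sup_norm_eq_Max_image)
qed

theorem corollary4p23:
  fixes \<Gamma> :: "('v, 'e) pre_digraph"
    and d :: nat
    and \<rho> :: "real \<Rightarrow> real"
    and u :: "'v \<Rightarrow> nat \<Rightarrow> 'b::banach"
    and a :: real
  assumes "d \<ge> 1"
    and "complete_digraph (d + 1) \<Gamma>"
    and "\<rho> \<in> {0..} \<rightarrow> {0..1}"
    and "antimono_on {0..} \<rho>"
    and "\<forall>v\<in>verts \<Gamma>. \<forall>t. time_diff u v t =
           laplacian \<Gamma> (\<lambda>v v'. \<rho> (norm (u v t - u v' t))) (\<lambda>v. u v t) v"
    and "a = \<rho> (grad_norm \<Gamma> (\<lambda>v. u v 0))"
    and "a > 0"
  shows "\<forall>t. grad_norm \<Gamma> (\<lambda>v. u v t)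
           \<le> exp (- a * real t * ((real d - 1) / real d)) * grad_norm \<Gamma> (\<lambda>v. u v 0)
       \<and> sup_norm \<Gamma> (\<lambda>v. u v t - average \<Gamma> (\<lambda>v. u v t))
           \<le> 2 * real d / (real d + 1) * exp (- a * real t * ((real d - 1) / real d))
             * sup_norm \<Gamma> (\<lambda>v. u v 0 - average \<Gamma> (\<lambda>v. u v 0))"
proof -
  define g where "g t = grad_norm \<Gamma> (\<lambda>v. u v t)" for t
  define b where "b = a * ((real d - 1) / real d)"
  have fin: "finite (verts \<Gamma>)" and card: "card (verts \<Gamma>) = d + 1"
    using assms(2) by (auto simp: complete_digraph_def intro: card_ge_0_finite)
  then have ne: "verts \<Gamma> \<noteq> {}"
    by auto
  have g_ge: "norm (u v t - u v' t) \<le> g t" if "v \<in> verts \<Gamma>" "v' \<in> verts \<Gamma>" for v v' t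
    using grad_norm_ge[OF fin that, of "\<lambda>v. u v t"] by (simp add: g_def)
  have g_nonneg: "0 \<le> g t" for t
    using ne g_ge norm_ge_zero order_trans by blast
  have a1: "a \<le> 1"
    using assms(3,6) g_nonneg[of 0] by (auto simp: g_def Pi_iff)
  have b: "0 \<le> b"
    using assms(1,7) by (simp add: b_def)
  \<comment> \<open>The premise keeps every distance at time \<open>t\<close> below
    \<open>g 0\<close>, where \<open>\<rho>\<close> is at least \<open>a\<close>.\<close>
  have step: "g (Suc t) \<le> (1 - b) * g t" if "g t \<le> g 0" for t
    unfolding g_def[of "Suc t"] b_def
  proof (intro grad_norm_le fin ne)
    fix v v' assume vv': "v \<in> verts \<Gamma>" "v' \<in> verts \<Gamma>"
    show "norm (u v (Suc t) - u v' (Suc t)) \<le> (1 - a * ((real d - 1) / real d)) * g t"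
    proof (rule averaging_step_contracts[OF fin card assms(1),
          where p = "\<lambda>v v'. \<rho> (norm (u v t - u v' t))" and x = "\<lambda>v. u v t"])
      fix v z assume vz: "v \<in> verts \<Gamma>" "z \<in> verts \<Gamma>"
      then have "norm (u v t - u z t) \<le> g 0"
        using g_ge that by (meson order_trans)
      then have "\<rho> (g 0) \<le> \<rho> (norm (u v t - u z t))"
        using monotone_onD[OF assms(4)] g_nonneg[of 0] by auto
      then show "a \<le> \<rho> (norm (u v t - u z t)) \<and> \<rho> (norm (u v t - u z t)) \<le> 1"
        using assms(3,6) by (auto simp: g_def Pi_iff)
    next
      fix v assume "v \<in> verts \<Gamma>"
      then have "time_diff u v t = (1 / real d) *\<^sub>R
          (\<Sum>z\<in>verts \<Gamma> - {v}. \<rho> (norm (u v t - u z t)) *\<^sub>R (u z t - u v t))"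
        using assms(5) laplacian_complete[OF assms(2)] by simp
      then show "u v (Suc t) = u v t + (1 / real d) *\<^sub>R
          (\<Sum>z\<in>verts \<Gamma> - {v}. \<rho> (norm (u v t - u z t)) *\<^sub>R (u z t - u v t))"
        by (simp add: time_diff_def algebra_simps)
    qed (use a1 assms(7) g_ge vv' in auto)
  qed
  have decay: "g t \<le> exp (- b * t) * g 0" for t
  proof (induction t)
    case (Suc t)
    \<comment> \<open>With the induction hypothesis this gives \<open>g t \<le> g 0\<close>, the
      premise of \<open>step\<close>, so monotonicity of \<open>g\<close> requires no separate
      induction.\<close>
    have "exp (- b * t) * g 0 \<le> 1 * g 0"
      using b g_nonneg by (intro mult_right_mono) auto
    then have "g (Suc t) \<le> (1 - b) * g t"
      using Suc step by simp
    also have "\<dots> \<le> exp (- b) * g t"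
      using exp_ge_add_one_self[of "- b"] g_nonneg by (intro mult_right_mono) auto
    also have "\<dots> \<le> exp (- b) * (exp (- b * t) * g 0)"
      using Suc by simp
    finally show ?case
      by (simp add: exp_add[symmetric] algebra_simps flip: mult.assoc)
  qed simp
  have eb: "exp (- a * real t * ((real d - 1) / real d)) = exp (- b * t)" for t
    by (simp add: b_def)
  show ?thesis
    unfolding eb
  proof (intro allI conjI)
    fix t
    show "grad_norm \<Gamma> (\<lambda>v. u v t) \<le> exp (- b * t) * grad_norm \<Gamma> (\<lambda>v. u v 0)"
      using decay by (simp add: g_def)
    let ?S = "\<lambda>t. sup_norm \<Gamma> (\<lambda>v. u v t - average \<Gamma> (\<lambda>v. u v t))"
    have "?S t \<le> real d / (real d + 1) * g t"
      unfolding g_def by (rule sup_norm_average_le_grad_norm[OF fin card])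
    \<comment> \<open>The gradient is compared with the deviation from the average once at time
      \<open>t\<close> and once at time 0; the factor 2 enters only at time 0.\<close>
    also have "\<dots> \<le> real d / (real d + 1) * (exp (- b * t) * (2 * ?S 0))"
      using decay[of t] grad_norm_le_sup_norm[OF fin ne, of "\<lambda>v. u v 0"]
      by (intro mult_left_mono) (auto simp: g_def intro: order_trans mult_left_mono)
    finally show "?S t \<le> 2 * real d / (real d + 1) * exp (- b * t) * ?S 0"
      by (simp add: mult_ac)
  qed
qed

end
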